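(* The assignment $\mathsf{M}\mapsto\operatorname{Spec}_{\mathsf{M}}(t,q)\in\mathbb{Z}[t,q]$, sending a matroid to its spectrum polynomial, is a valuative invariant.
   Context: All matroids have finite ground sets contained in the positive integers. The spectrum polynomial of a matroid $\mathsf{M}$ is \[\operatorname{Spec}_{\mathsf{M}}(t,q)=\sum_{\substack{F_1,F_2\in\mathcal{L}(\mathsf{M}) \\ F_1\subseteq F_2}}|\tilde\chi(\mathsf{M}|_{F_1})|\cdot|\mu_{\mathcal{L}(\mathsf{M})}(F_1,F_2)|\cdot t^{\operatorname{rk}(F_2)}q^{|F_1|},\] where $\mathcal{L}(\mathsf{M})$ is the lattice of flats, $\mu_{\mathcal{L}(\mathsf{M})}$ its Möbius function, and $\tilde\chi(\mathsf{N})$ is the reduced Euler characteristic of the independence complex of $\mathsf{N}$ (so $|\tilde\chi(\mathsf{N})|=T_{\mathsf{N}}(0,1)$ with $T$ the Tutte polynomial). The base polytope of a matroid $\mathsf{M}$ on $E$ with bases $\mathscr{B}$ is $\mathscr{P}(\mathsf{M})=\operatorname{conv}\{\sum_{i\in B}e_i : B\in\mathscr{B}\}\subseteq\mathbb{R}^E$, with indicator function $\mathbf{1}_{\mathscr{P}(\mathsf{M})}:\mathbb{R}^E\to\mathbb{Z}$. A map $f$ from matroids to an abelian group is a valuation if $\sum_{i}a_if(\mathsf{M}_i)=0$ whenever $\mathsf{M}_1,\dots,\mathsf{M}_s$ are matroids on a common ground set and $a_i\in\mathbb{Z}$ satisfy $\sum_i a_i\mathbf{1}_{\mathscr{P}(\mathsf{M}_i)}=0$.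 (This is known to be equivalent to the inclusion–exclusion property under matroid subdivisions.) A valuative invariant is a valuation with $f(\mathsf{M})=f(\mathsf{N})$ whenever $\mathsf{M}\cong\mathsf{N}$. *)

theory Defs
  imports
    "HOL-Analysis.Analysis"
    "HOL-Analysis.Finite_Function_Topology"
    "HOL-Computational_Algebra.Polynomial"
begin

section \<open>Matroids\<close>

datatype matroid = Matroid (ground: "nat set") (indep: "nat set set")

definition is_matroid :: "matroid \<Rightarrow> bool" where
  "is_matroid M \<longleftrightarrow>
     finite (ground M) \<and> (\<forall>e\<in>ground M. 0 < e) \<and>
     (\<forall>I\<in>indep M. I \<subseteq> ground M) \<and>
     {} \<in> indep M \<and>
     (\<forall>I\<in>indep M. \<forall>J. J \<subseteq> I \<longrightarrow> J \<in> indep M) \<and>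
     (\<forall>I\<in>indep M. \<forall>J\<in>indep M. card I < card J \<longrightarrow> (\<exists>x\<in>J - I. insert x I \<in> indep M))"

definition bases :: "matroid \<Rightarrow> nat set set" where
  "bases M = {B \<in> indep M. \<forall>I\<in>indep M. B \<subseteq> I \<longrightarrow> I = B}"

definition rk :: "matroid \<Rightarrow> nat set \<Rightarrow> nat" where
  "rk M A = Max (card ` {I \<in> indep M. I \<subseteq> A})"

definition restrict_matroid :: "matroid \<Rightarrow> nat set \<Rightarrow> matroid" where
  "restrict_matroid M A = Matroid (ground M \<inter> A) {I \<in> indep M. I \<subseteq> A}"

definition flats :: "matroid \<Rightarrow> nat set set" where
  "flats M = {F. F \<subseteq> ground M \<and> (\<forall>x\<in>ground M - F. rk M F < rk M (insert x F))}"

definition matroid_iso :: "matroid \<Rightarrow> matroid \<Rightarrow> bool" where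
  "matroid_iso M N \<longleftrightarrow>
     (\<exists>\<phi>. bij_betw \<phi> (ground M) (ground N) \<and>
          (\<forall>I. I \<subseteq> ground M \<longrightarrow> (I \<in> indep M \<longleftrightarrow> \<phi> ` I \<in> indep N)))"


section \<open>The spectrum polynomial\<close>

text \<open>The face \<open>I\<close> has dimension \<open>card I - 1\<close>; the empty face contributes \<open>-1\<close>.\<close>

definition reduced_euler_char :: "nat set set \<Rightarrow> int" where
  "reduced_euler_char \<Delta> = (\<Sum>I\<in>\<Delta>. (- 1) ^ (card I + 1))"

text \<open>The Moebius function of a finite family \<open>L\<close> of finite sets, ordered by inclusion.\<close>

function moebius :: "nat set set \<Rightarrow> nat set \<Rightarrow> nat set \<Rightarrow> int" where
  "moebius L F G =
     (if F = G then 1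
      else if F \<subset> G \<and> finite G then - (\<Sum>H\<in>{H \<in> L. F \<subseteq> H \<and> H \<subset> G}. moebius L F H)
      else 0)"
  by pat_completeness auto
termination
  by (relation "Wellfounded.measure (\<lambda>(L, F, G). card G)") (auto intro: psubset_card_mono)

declare moebius.simps [simp del]

text \<open>\<open>\<int>[t,q]\<close> is rendered as \<open>\<int>[t][q]\<close>: the outer variable of \<^typ>\<open>int poly poly\<close> is \<open>q\<close>,
  the inner one is \<open>t\<close>, so \<open>monom (monom c i) j\<close> is \<open>c t\<^sup>i q\<^sup>j\<close>.\<close>

definition Spec :: "matroid \<Rightarrow> int poly poly" where
  "Spec M =
     (\<Sum>(F1, F2)\<in>{(F1, F2). F1 \<in> flats M \<and> F2 \<in> flats M \<and> F1 \<subseteq> F2}.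
        monom (monom (\<bar>reduced_euler_char (indep (restrict_matroid M F1))\<bar> * \<bar>moebius (flats M) F1 F2\<bar>)
                     (rk M F2))
              (card F1))"


section \<open>Valuations\<close>

text \<open>\<open>\<real>\<^sup>E\<close> is the space of finitely supported functions \<^typ>\<open>nat \<Rightarrow>\<^sub>0 real\<close> whose support
  lies in \<open>E\<close>; this puts the spaces for all ground sets into one real vector space.\<close>

definition coord_space :: "nat set \<Rightarrow> (nat \<Rightarrow>\<^sub>0 real) set" where
  "coord_space E = {x. Poly_Mapping.keys x \<subseteq> E}"

definition base_polytope :: "matroid \<Rightarrow> (nat \<Rightarrow>\<^sub>0 real) set" where
  "base_polytope M = convex hull ((\<lambda>B. \<Sum>i\<in>B. Poly_Mapping.single i 1) ` bases M)"

text \<open>The action of the integers on an arbitrary abelian group.\<close>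

definition int_scale :: "int \<Rightarrow> 'g::ab_group_add \<Rightarrow> 'g" where
  "int_scale a x = (if 0 \<le> a then (\<Sum>_<nat a. x) else - (\<Sum>_<nat (- a). x))"

definition valuation :: "(matroid \<Rightarrow> 'g::ab_group_add) \<Rightarrow> bool" where
  "valuation f \<longleftrightarrow>
     (\<forall>E (s::nat) (M :: nat \<Rightarrow> matroid) (a :: nat \<Rightarrow> int).
        (\<forall>i<s. is_matroid (M i) \<and> ground (M i) = E) \<longrightarrow>
        (\<forall>x\<in>coord_space E. (\<Sum>i<s. a i * indicator (base_polytope (M i)) x) = 0) \<longrightarrow>
        (\<Sum>i<s. int_scale (a i) (f (M i))) = 0)"

definition valuative_invariant :: "(matroid \<Rightarrow> 'g::ab_group_add) \<Rightarrow> bool" where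
  "valuative_invariant f \<longleftrightarrow>
     valuation f \<and>
     (\<forall>M N. is_matroid M \<longrightarrow> is_matroid N \<longrightarrow> matroid_iso M N \<longrightarrow> f M = f N)"

end

theory Submission
  imports Defs
begin

text \<open>Deletion and contraction give the signs of the reduced Euler characteristic and of the Moebius
  function, and \<open>\<mu>(F, G)\<close> is the alternating count of the sets between \<open>F\<close> and \<open>G\<close> that span \<open>G\<close>; for
  a set \<open>S\<close> that is not a flat the analogous count vanishes. So the coefficient of \<open>t\<^sup>k q\<^sup>j\<close> is
  \<open>\<Sum> (- 1)\<^bsup>k + card B + card I\<^esup>\<close> over \<open>I \<subseteq> S \<subseteq> S \<union> B\<close> with \<open>card S = j\<close>, \<open>B\<close> disjoint from \<open>S\<close>, \<open>I\<close>
  independent and \<open>rk (S \<union> B) = k\<close>. This is visibly invariant under isomorphism, and it suffices that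
  for fixed \<open>I \<subseteq> A\<close> the indicator of ``\<open>I\<close> is independent and \<open>rk A = k\<close>'' is a valuation. It is a
  difference of indicators of ``the base polytope meets the half-spaces \<open>x(I) \<ge> card I\<close> and
  \<open>x(A) \<ge> c\<close>'', which are valuations because the Euler characteristic of compact convex sets is.\<close>

section \<open>The Euler characteristic of compact convex sets\<close>

text \<open>Compare the relation at \<open>t\<close> with the relation at a point \<open>v\<close>
  slightly below \<open>t\<close>: only intervals starting at \<open>t\<close> contain one of the
  two points but not the other. Hence the weights of the intervals with a given left endpoint
  cancel, and summing over the left endpoints gives the claim.\<close>

lemma sum_intervals_eq_0:
  fixes a :: "'i \<Rightarrow> int" and l u :: "'i \<Rightarrow> real"
  assumes fin: "finite J" and le: "\<And>i. i \<in> J \<Longrightarrow> l i \<le> u i"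
    and zero: "\<And>t. (\<Sum>i\<in>J. a i * of_bool (l i \<le> t \<and> t \<le> u i)) = 0"
  shows "(\<Sum>i\<in>J. a i) = 0"
proof -
  have start: "(\<Sum>i\<in>{i\<in>J. l i = t}. a i) = 0" for t
  proof -
    \<comment> \<open>The element \<open>t - 1\<close> keeps \<open>D\<close> nonempty when no
      endpoint lies below \<open>t\<close>. Any \<open>v\<close> between \<open>Max D\<close> and
      \<open>t\<close> then has no endpoint in \<open>{v..<t}\<close>.\<close>
    define D where "D = insert (t - 1) {e \<in> l ` J \<union> u ` J. e < t}"
    have D: "finite D" "D \<noteq> {}" unfolding D_def using fin by auto
    have "Max D < t" using D by (subst Max_less_iff) (auto simp: D_def)
    then obtain v where v: "Max D < v" "v < t" using dense by blast
    have below: "e < v" if "e \<in> l ` J \<union> u ` J" "e < t" for e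
      proof -
      have "e \<in> D" using that by (simp add: D_def)
      then have "e \<le> Max D" using D(1) by simp
      then show ?thesis using v(1) by simp
    qed
    have "(\<Sum>i\<in>{i\<in>J. l i = t}. a i) = (\<Sum>i\<in>J. a i * of_bool (l i = t))"
      using fin by (simp add: sum_mult_of_bool_eq Collect_conj_eq)
    also have "\<dots> = (\<Sum>i\<in>J. a i * of_bool (l i \<le> t \<and> t \<le> u i) - a i * of_bool (l i \<le> v \<and> v \<le> u i))"
    proof (rule sum.cong)
      fix i assume i: "i \<in> J"
      have "l i < t \<Longrightarrow> l i < v" "u i < t \<Longrightarrow> u i < v" using below i by auto
      then show "a i * of_bool (l i = t)
          = a i * of_bool (l i \<le> t \<and> t \<le> u i) - a i * of_bool (l i \<le> v \<and> v \<le> u i)"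
        using le[OF i] v(2) by (auto simp: of_bool_def)
    qed simp
    also have "\<dots> = 0" by (simp add: sum_subtractf zero)
    finally show ?thesis .
  qed
  have "(\<Sum>i\<in>J. a i) = (\<Sum>t\<in>l ` J. \<Sum>i\<in>{i\<in>J. l i = t}. a i)"
    using fin by (simp add: sum.image_gen)
  then show ?thesis by (simp add: start)
qed

text \<open>Slicing by the level sets of one functional \<open>f\<close> leaves the same relation between the intervals
  \<open>f ` C i\<close>.\<close>

lemma sum_nonempty_eq_0_if_sum_indicator_eq_0:
  fixes a :: "'i \<Rightarrow> int" and C :: "'i \<Rightarrow> 'a::real_normed_vector set" and \<Phi> :: "('a \<Rightarrow> real) set"
  assumes "finite \<Phi>" "\<And>f. f \<in> \<Phi> \<Longrightarrow> bounded_linear f" "finite J"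
    and "\<And>i. i \<in> J \<Longrightarrow> compact (C i)" "\<And>i. i \<in> J \<Longrightarrow> convex (C i)"
    and "\<And>x. (\<Sum>i\<in>J. a i * of_bool (x \<in> C i)) = 0"
    and "\<And>i j x y. \<lbrakk>i \<in> J; j \<in> J; x \<in> C i; y \<in> C j; \<forall>f\<in>\<Phi>. f x = f y\<rbrakk> \<Longrightarrow> x = y"
  shows "(\<Sum>i\<in>J. a i * of_bool (C i \<noteq> {})) = 0"
  using assms
proof (induction \<Phi> arbitrary: C)
  case empty
  show ?case
  proof (cases "\<exists>i\<in>J. C i \<noteq> {}")
    case True
    \<comment> \<open>With no functionals left, the separation hypothesis identifies all points of
      all the sets, so the nonempty \<open>C i\<close> are one and the same singleton.\<close>
    then obtain x where "\<And>i. i \<in> J \<Longrightarrow> C i \<noteq> {} \<longleftrightarrow> x \<in> C i"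
      using empty.prems(6) by (metis all_not_in_conv ball_empty)
    then show ?thesis using empty.prems(5)[of x] by simp
  qed simp
next
  case (insert f \<Phi>)
  have f: "bounded_linear f" and lin: "linear f"
    using insert.prems(1) by (auto simp: bounded_linear.linear)
  \<comment> \<open>On a level set of \<open>f\<close> the remaining functionals already separate
    points, so the induction hypothesis applies to the slices.\<close>
  have slice: "(\<Sum>i\<in>J. a i * of_bool (C i \<inter> f -` {t} \<noteq> {})) = 0" for t
  proof (rule insert.IH)
    fix i assume i: "i \<in> J"
    have "closed (f -` {t})"
      by (intro continuous_closed_vimage) (auto intro: linear_continuous_at f)
    then show "compact (C i \<inter> f -` {t})" using insert.prems(3)[OF i] by (rule compact_Int_closed[rotated])
    show "convex (C i \<inter> f -` {t})"
      using insert.prems(4)[OF i] lin by (intro convex_Int convex_linear_vimage) auto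
  next
    fix x show "(\<Sum>i\<in>J. a i * of_bool (x \<in> C i \<inter> f -` {t})) = 0"
      using insert.prems(5)[of x] by (cases "f x = t") auto
  next
    fix i j x y assume "i \<in> J" "j \<in> J" "x \<in> C i \<inter> f -` {t}" "y \<in> C j \<inter> f -` {t}" "\<forall>f\<in>\<Phi>. f x = f y"
    then show "x = y" using insert.prems(6)[of i j x y] by auto
  qed (use insert.prems in auto)
  \<comment> \<open>An empty \<open>C i\<close> would give an interval with
    \<open>l i > u i\<close>, which the interval lemma excludes.\<close>
  define J' where "J' = {i \<in> J. C i \<noteq> {}}"
  have "\<exists>l u. f ` C i = {l..u}" if "i \<in> J" for i
  proof -
    have "compact (f ` C i)" using insert.prems(3)[OF that] f
      by (intro compact_continuous_image linear_continuous_on) auto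
    moreover have "connected (f ` C i)" using insert.prems(4)[OF that] lin
      by (intro convex_connected convex_linear_image) auto
    ultimately show ?thesis using connected_compact_interval_1 by blast
  qed
  then obtain l u where lu: "\<And>i. i \<in> J \<Longrightarrow> f ` C i = {l i..u i}" by metis
  have "(\<Sum>i\<in>J'. a i) = 0"
  proof (rule sum_intervals_eq_0)
    show "finite J'" using insert.prems(2) by (simp add: J'_def)
    show "l i \<le> u i" if "i \<in> J'" for i
      using that lu[of i] by (auto simp: J'_def)
    fix t
    have "(\<Sum>i\<in>J'. a i * of_bool (l i \<le> t \<and> t \<le> u i)) = (\<Sum>i\<in>J. a i * of_bool (C i \<inter> f -` {t} \<noteq> {}))"
    proof (rule sum.mono_neutral_cong_left)
      show "a i * of_bool (l i \<le> t \<and> t \<le> u i) = a i * of_bool (C i \<inter> f -` {t} \<noteq> {})" if "i \<in> J'" for i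
      proof -
        have "l i \<le> t \<and> t \<le> u i \<longleftrightarrow> t \<in> f ` C i" using that lu[of i] by (auto simp: J'_def)
        also have "\<dots> \<longleftrightarrow> C i \<inter> f -` {t} \<noteq> {}" by blast
        finally show ?thesis by simp
      qed
    qed (use insert.prems(2) in \<open>auto simp: J'_def\<close>)
    then show "(\<Sum>i\<in>J'. a i * of_bool (l i \<le> t \<and> t \<le> u i)) = 0" using slice by simp
  qed
  then show ?case using insert.prems(2)
    by (simp add: J'_def sum_mult_of_bool_eq Collect_conj_eq)
qed

section \<open>Rank functions and signs of alternating sums\<close>

lemma
  assumes "is_matroid M"
  shows matroid_finite_ground: "finite (ground M)"
    and matroid_empty_indep: "{} \<in> indep M"
    and matroid_indep_subset_ground: "I \<in> indep M \<Longrightarrow> I \<subseteq> ground M"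
    and matroid_indep_mono: "I \<in> indep M \<Longrightarrow> J \<subseteq> I \<Longrightarrow> J \<in> indep M"
    and matroid_augment:
      "\<lbrakk>I \<in> indep M; J \<in> indep M; card I < card J\<rbrakk> \<Longrightarrow> \<exists>x\<in>J - I. insert x I \<in> indep M"
  proof -
  note ax = assms[unfolded is_matroid_def]
  show "finite (ground M)" "{} \<in> indep M" using ax by simp_all
  show "I \<subseteq> ground M" if "I \<in> indep M" using ax that by simp
  show "J \<in> indep M" if "I \<in> indep M" "J \<subseteq> I"
    using ax that by metis
  show "\<exists>x\<in>J - I. insert x I \<in> indep M" if "I \<in> indep M" "J \<in> indep M" "card I < card J"
    using ax that by metis
qed

lemma matroid_finite_indep: "\<lbrakk>is_matroid M; I \<in> indep M\<rbrakk> \<Longrightarrow> finite I"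
  by (rule finite_subset[OF matroid_indep_subset_ground matroid_finite_ground])

lemma matroid_finite_indeps: "is_matroid M \<Longrightarrow> finite (indep M)"
  by (rule finite_subset[of _ "Pow (ground M)"])
     (auto simp: matroid_finite_ground dest: matroid_indep_subset_ground)

lemma card_le_rk: "\<lbrakk>is_matroid M; I \<in> indep M; I \<subseteq> A\<rbrakk> \<Longrightarrow> card I \<le> rk M A"
  unfolding rk_def by (rule Max_ge) (auto simp: matroid_finite_indeps)

lemma rk_attained:
  assumes "is_matroid M"
  obtains I where "I \<in> indep M" "I \<subseteq> A" "card I = rk M A"
proof -
  have "rk M A \<in> card ` {I \<in> indep M. I \<subseteq> A}"
    unfolding rk_def
    by (rule Max_in)
       (use assms in \<open>auto simp: matroid_finite_indeps intro!: exI[of _ "{}"] matroid_empty_indep\<close>)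
  then show ?thesis using that by auto
qed

text \<open>Take a maximal independent set between \<open>I\<close> and \<open>A\<close>. If it were
  smaller than \<open>rk M A\<close>, augmentation from a largest independent subset of
  \<open>A\<close> would enlarge it.\<close>

lemma indep_extends_to_rk:
  assumes M: "is_matroid M" and I: "I \<in> indep M" "I \<subseteq> A"
  obtains J where "J \<in> indep M" "I \<subseteq> J" "J \<subseteq> A" "card J = rk M A"
proof -
  define K where "K = {J \<in> indep M. I \<subseteq> J \<and> J \<subseteq> A}"
  have "finite K" "I \<in> K" using I matroid_finite_indeps[OF M] by (auto simp: K_def)
  then obtain J where J: "J \<in> K" and max: "\<And>J'. J' \<in> K \<Longrightarrow> J \<subseteq> J' \<Longrightarrow> J' = J"
    using finite_has_maximal[of K] by blast
  have "card J = rk M A"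
  proof (rule ccontr)
    assume "card J \<noteq> rk M A"
    moreover have "card J \<le> rk M A" using J by (auto simp: K_def intro: card_le_rk[OF M])
    ultimately have less: "card J < rk M A" by simp
    obtain D where D: "D \<in> indep M" "D \<subseteq> A" "card D = rk M A" using rk_attained[OF M] .
    obtain x where "x \<in> D - J" "insert x J \<in> indep M"
      using matroid_augment[OF M, of J D] J D less by (auto simp: K_def)
    then have "insert x J \<in> K" using J D by (auto simp: K_def)
    then show False using max[of "insert x J"] \<open>x \<in> D - J\<close> by blast
  qed
  then show ?thesis using that J by (auto simp: K_def)
qed

lemma rk_empty: "is_matroid M \<Longrightarrow> rk M {} = 0"
  by (metis card.empty rk_attained subset_empty)

lemma rk_mono: "\<lbrakk>is_matroid M; A \<subseteq> B\<rbrakk> \<Longrightarrow> rk M A \<le> rk M B"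
  by (metis card_le_rk order_trans rk_attained)

lemma rk_insert_le:
  assumes M: "is_matroid M"
  shows "rk M (insert e A) \<le> Suc (rk M A)"
proof -
  obtain I where I: "I \<in> indep M" "I \<subseteq> insert e A" "card I = rk M (insert e A)"
    using rk_attained[OF M] .
  have "I - {e} \<in> indep M" using matroid_indep_mono[OF M I(1)] by blast
  then have "card (I - {e}) \<le> rk M A" using I by (intro card_le_rk[OF M]) auto
  then show ?thesis using I(3) by (metis card_Diff_singleton_if diff_le_self le_SucI Suc_le_mono card_gt_0_iff le_diff_conv add.commute plus_1_eq_Suc le_trans)
qed

lemma rk_Un_le:
  assumes M: "is_matroid M" and "finite B"
  shows "rk M (A \<union> B) \<le> rk M A + card B"
  using \<open>finite B\<close>
proof (induction B)
  case (insert b B)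
  then show ?case using rk_insert_le[OF M, of b "A \<union> B"] by simp
qed simp

text \<open>This is the local form of submodularity: a loop after contracting \<open>A\<close> is
  still a loop after contracting \<open>B\<close>. Otherwise a largest independent subset
  \<open>J\<close> of \<open>B\<close>, chosen to extend a largest one \<open>I\<close> of
  \<open>A\<close>, could be augmented by \<open>e\<close>; then \<open>insert e I\<close> would be
  independent and \<open>e\<close> would raise the rank of \<open>A\<close>.\<close>

lemma rk_insert_eq_mono:
  assumes M: "is_matroid M" and eq: "rk M (insert e A) = rk M A" and "A \<subseteq> B"
  shows "rk M (insert e B) = rk M B"
proof (rule ccontr)
  assume neq: "rk M (insert e B) \<noteq> rk M B"
  have "rk M B < rk M (insert e B)" using neq rk_mono[OF M subset_insertI, of B e] by simp
  obtain I where I: "I \<in> indep M" "I \<subseteq> A" "card I = rk M A" using rk_attained[OF M] .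
  obtain J where J: "J \<in> indep M" "I \<subseteq> J" "J \<subseteq> B" "card J = rk M B"
    using indep_extends_to_rk[OF M I(1)] I(2) \<open>A \<subseteq> B\<close> by (metis order_trans)
  obtain D where D: "D \<in> indep M" "D \<subseteq> insert e B" "card D = rk M (insert e B)"
    using rk_attained[OF M] .
  obtain x where x: "x \<in> D - J" "insert x J \<in> indep M"
    using matroid_augment[OF M J(1) D(1)] J(4) D(3) \<open>rk M B < _\<close> by auto
  have finJ: "finite J" using matroid_finite_indep[OF M J(1)] .
  \<comment> \<open>\<open>J\<close> already has the largest size possible inside \<open>B\<close>,
    so the augmenting element must be \<open>e\<close>.\<close>
  have "x \<notin> B"
  proof
    assume "x \<in> B"
    then have "card (insert x J) \<le> rk M B" using x J by (intro card_le_rk[OF M]) auto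
    then show False using x(1) J(4) finJ by simp
  qed
  then have "x = e" using x(1) D(2) by auto
  have "insert e I \<in> indep M" using matroid_indep_mono[OF M x(2)] J(2) \<open>x = e\<close> by blast
  then have "card (insert e I) \<le> rk M (insert e A)" using I(2) by (intro card_le_rk[OF M]) auto
  moreover have "e \<notin> I" using x(1) J(2) \<open>x = e\<close> by auto
  ultimately show False using eq I(3) finite_subset[OF J(2) finJ] by simp
qed

lemma rk_Un_eq_if_rk_insert_eq:
  assumes M: "is_matroid M" and "finite B" and eq: "\<And>e. e \<in> B \<Longrightarrow> rk M (insert e A) = rk M A"
  shows "rk M (A \<union> B) = rk M A"
  using \<open>finite B\<close> eq
proof (induction B)
  case (insert b B)
  then show ?case using rk_insert_eq_mono[OF M, of b A "A \<union> B"] by auto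
qed simp

lemma indep_iff_rk:
  assumes M: "is_matroid M" and "finite I"
  shows "I \<in> indep M \<longleftrightarrow> rk M I = card I"
proof
  assume "I \<in> indep M"
  then show "rk M I = card I"
    using card_le_rk[OF M, of I I] rk_Un_le[OF M \<open>finite I\<close>, of "{}"] rk_empty[OF M] by simp
next
  assume *: "rk M I = card I"
  obtain J where "J \<in> indep M" "J \<subseteq> I" "card J = rk M I" using rk_attained[OF M] .
  then show "I \<in> indep M" using * card_subset_eq[OF \<open>finite I\<close>] by metis
qed

section \<open>Alternating sums over minors, by deletion and contraction\<close>

text \<open>The sums range over the independent, respectively spanning, sets of the minor of \<open>M\<close> on \<open>X\<close>
  obtained by contracting \<open>C\<close>.\<close>

definition alt_indep :: "matroid \<Rightarrow> nat set \<Rightarrow> nat set \<Rightarrow> int" where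
  "alt_indep M C X = (\<Sum>I\<in>{I. I \<subseteq> X \<and> rk M (C \<union> I) = rk M C + card I}. (- 1) ^ card I)"

definition alt_span :: "matroid \<Rightarrow> nat set \<Rightarrow> nat set \<Rightarrow> int" where
  "alt_span M C X = (\<Sum>A\<in>{A. A \<subseteq> X \<and> rk M (C \<union> A) = rk M (C \<union> X)}. (- 1) ^ card A)"

lemma card_insert_subset: "\<lbrakk>finite X; e \<notin> X; A \<subseteq> X\<rbrakk> \<Longrightarrow> card (insert e A) = Suc (card A)"
  by (meson card_insert_disjoint finite_subset subsetD)

lemma alt_span_empty: "alt_span M C {} = 1"
proof -
  have "{A. A = {} \<and> rk M (C \<union> A) = rk M C} = {{}}" by auto
  then show ?thesis by (simp add: alt_span_def)
qed

text \<open>Splitting by membership of \<open>e\<close> is the source of every deletion-contraction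
  step and of every cancelling pairing below.\<close>

lemma sum_subsets_insert:
  fixes f :: "'a set \<Rightarrow> int"
  assumes "finite X" "e \<notin> X"
  shows "(\<Sum>A\<in>{A. A \<subseteq> insert e X \<and> P A}. f A)
    = (\<Sum>A\<in>{A. A \<subseteq> X \<and> P A}. f A) + (\<Sum>A\<in>{A. A \<subseteq> X \<and> P (insert e A)}. f (insert e A))"
proof -
  have "{A. A \<subseteq> insert e X \<and> P A} = {A. A \<subseteq> X \<and> P A} \<union> insert e ` {A. A \<subseteq> X \<and> P (insert e A)}"
    (is "?L = ?R")
  proof
    show "?L \<subseteq> ?R"
    proof
      fix A assume A: "A \<in> ?L"
      show "A \<in> ?R"
      proof (cases "e \<in> A")
        case True
        then have "A = insert e (A - {e})" by blast
        then show ?thesis using A by (intro UnI2 image_eqI[of _ _ "A - {e}"]) auto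
      qed (use A in auto)
    qed
  qed auto
  moreover have "inj_on (insert e) {A. A \<subseteq> X \<and> P (insert e A)}"
    using assms(2) by (auto simp: inj_on_def)
  ultimately show ?thesis using assms by (subst (1) \<open>?L = ?R\<close>, subst sum.union_disjoint)
    (auto simp: sum.reindex)
qed

text \<open>Sets without \<open>e\<close> belong to the deletion of \<open>e\<close>. Sets
  containing \<open>e\<close> belong to its contraction and have one more element, hence the minus
  sign; if \<open>e\<close> is a loop there are none.\<close>

lemma alt_indep_insert:
  assumes M: "is_matroid M" and X: "finite X" "e \<notin> X"
  shows "alt_indep M C (insert e X)
    = (if rk M (insert e C) = rk M C then alt_indep M C X
       else alt_indep M C X - alt_indep M (insert e C) X)"
proof -
  let ?R = "{I. I \<subseteq> X \<and> rk M (C \<union> insert e I) = rk M C + card (insert e I)}"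
  have fin: "finite I" "e \<notin> I" "card (insert e I) = Suc (card I)" if "I \<subseteq> X" for I
    using that X finite_subset[OF that X(1)] card_insert_subset[OF X that] by auto
  have split: "alt_indep M C (insert e X) = alt_indep M C X + (\<Sum>I\<in>?R. (- 1) ^ card (insert e I))"
    unfolding alt_indep_def using sum_subsets_insert[OF X] by simp
  show ?thesis
  proof (cases "rk M (insert e C) = rk M C")
    case True
    have "?R = {}"
    proof (rule equals0I, clarify)
      fix I assume I: "I \<subseteq> X" "rk M (C \<union> insert e I) = rk M C + card (insert e I)"
      have "rk M (C \<union> insert e I) \<le> rk M (insert e C) + card I"
        using rk_Un_le[OF M fin(1)[OF I(1)], of "insert e C"] by simp
      then show False using I(2) True fin(3)[OF I(1)] by simp
    qed
    then have "(\<Sum>I\<in>?R. (- 1 :: int) ^ card (insert e I)) = 0" by (simp only: sum.empty)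
    then show ?thesis using split True by simp
  next
    case False
    then have "rk M (insert e C) = Suc (rk M C)"
      using rk_insert_le[OF M, of e C] rk_mono[OF M subset_insertI, of C e] by simp
    then have "?R = {I. I \<subseteq> X \<and> rk M (insert e C \<union> I) = rk M (insert e C) + card I}"
      using fin by auto
    moreover have "(\<Sum>I\<in>?R. (- 1) ^ card (insert e I)) = - (\<Sum>I\<in>?R. (- 1 :: int) ^ card I)"
      unfolding sum_negf[symmetric] by (rule sum.cong) (auto simp: fin)
    ultimately show ?thesis using split False by (simp add: alt_indep_def)
  qed
qed

text \<open>Sets with \<open>e\<close> are spanning sets of the contraction with the sign reversed.
  Sets without \<open>e\<close> can span only if \<open>e\<close> is not a coloop.\<close>

lemma alt_span_insert:
  assumes M: "is_matroid M" and X: "finite X" "e \<notin> X"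
  shows "alt_span M C (insert e X)
    = (if rk M (C \<union> insert e X) = rk M (C \<union> X) then alt_span M C X - alt_span M (insert e C) X
       else - alt_span M (insert e C) X)"
proof -
  let ?r = "rk M (C \<union> insert e X)"
  let ?L = "{A. A \<subseteq> X \<and> rk M (C \<union> A) = ?r}" and ?R = "{A. A \<subseteq> X \<and> rk M (C \<union> insert e A) = ?r}"
  have fin: "card (insert e A) = Suc (card A)" if "A \<subseteq> X" for A
    using card_insert_subset[OF X that] .
  have "alt_span M C (insert e X) = (\<Sum>A\<in>?L. (- 1) ^ card A) + (\<Sum>A\<in>?R. (- 1) ^ card (insert e A))"
    unfolding alt_span_def using sum_subsets_insert[OF X] by simp
  moreover have "(\<Sum>A\<in>?R. (- 1) ^ card (insert e A)) = - (\<Sum>A\<in>?R. (- 1 :: int) ^ card A)"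
    unfolding sum_negf[symmetric] by (rule sum.cong) (auto simp: fin)
  moreover have "(\<Sum>A\<in>?R. (- 1) ^ card A) = alt_span M (insert e C) X"
    by (simp add: alt_span_def)
  moreover have "(\<Sum>A\<in>?L. (- 1) ^ card A) = (if ?r = rk M (C \<union> X) then alt_span M C X else 0)"
  proof (cases "?r = rk M (C \<union> X)")
    case False
    have "rk M (C \<union> A) \<le> rk M (C \<union> X)" if "A \<subseteq> X" for A using that by (intro rk_mono[OF M]) auto
    moreover have "rk M (C \<union> X) < ?r"
      using False rk_mono[OF M subset_insertI, of "C \<union> X" e] by simp
    ultimately have "?L = {}" by (metis (mono_tags, lifting) empty_Collect_eq leD)
    then show ?thesis using False by (simp only: sum.empty if_False)
  qed (simp add: alt_span_def)
  ultimately show ?thesis by auto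
qed

text \<open>A coloop raises the rank of every \<open>C \<union> I\<close> by exactly one, so
  independence over \<open>C\<close> and over \<open>insert e C\<close> agree on subsets of
  \<open>X\<close>. The two terms of the recursion therefore cancel: the independence complex is a
  cone with apex \<open>e\<close>.\<close>

lemma alt_indep_contract_coloop:
  assumes M: "is_matroid M" and X: "finite X" "rk M (insert e (C \<union> X)) \<noteq> rk M (C \<union> X)"
  shows "alt_indep M (insert e C) X = alt_indep M C X"
proof -
  have step: "rk M (insert e (C \<union> I)) = Suc (rk M (C \<union> I))" if "I \<subseteq> X" for I
    using that X(2) rk_insert_eq_mono[OF M, of e "C \<union> I" "C \<union> X"]
      rk_insert_le[OF M, of e "C \<union> I"] rk_mono[OF M, of "C \<union> I" "insert e (C \<union> I)"]
    by (metis Un_mono le_antisym not_less_eq_eq order_refl subset_insertI)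
  have "rk M (insert e C \<union> I) = rk M (insert e C) + card I \<longleftrightarrow> rk M (C \<union> I) = rk M C + card I"
    if "I \<subseteq> X" for I
    using step[OF that] step[of "{}"] by simp
  then show ?thesis unfolding alt_indep_def by (metis (no_types, lifting))
qed

text \<open>Dually, a loop leaves all ranks over \<open>C\<close> unchanged, so for a loop the two
  terms of the recursion for \<open>alt_span\<close> cancel.\<close>

lemma alt_span_contract_loop:
  assumes M: "is_matroid M" and e: "rk M (insert e C) = rk M C"
  shows "alt_span M (insert e C) X = alt_span M C X"
proof -
  have "rk M (insert e C \<union> A) = rk M (C \<union> A)" for A
    using rk_insert_eq_mono[OF M e, of "C \<union> A"] by simp
  then show ?thesis by (simp add: alt_span_def)
qed

text \<open>The exponent has the parity of the rank of the minor and is written as a sum to avoid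
  subtraction of naturals. A loop changes nothing and a coloop makes the sum zero. Otherwise
  deletion keeps the rank of the minor and contraction lowers it by one, so after applying the sign
  the difference becomes a sum of nonnegative terms.\<close>

lemma alt_indep_sign:
  assumes M: "is_matroid M" and "finite X"
  shows "0 \<le> (- 1) ^ (rk M (C \<union> X) + rk M C) * alt_indep M C X"
  using \<open>finite X\<close>
proof (induction X arbitrary: C)
  case empty
  have "{I. I = {} \<and> rk M (C \<union> I) = rk M C + card I} = {{}}" by auto
  then show ?case by (simp add: alt_indep_def)
next
  case (insert e X)
  note ins = alt_indep_insert[OF M insert.hyps, of C]
  consider (loop) "rk M (insert e C) = rk M C"
    | (coloop) "rk M (insert e C) = Suc (rk M C)" "rk M (insert e (C \<union> X)) \<noteq> rk M (C \<union> X)"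
    | (neither) "rk M (insert e C) = Suc (rk M C)" "rk M (insert e (C \<union> X)) = rk M (C \<union> X)"
    using rk_insert_le[OF M, of e C] rk_mono[OF M, of C "insert e C"]
    by (metis le_SucE le_antisym subset_insertI)
  then show ?case
  proof cases
    case loop
    then have "rk M (insert e (C \<union> X)) = rk M (C \<union> X)" by (rule rk_insert_eq_mono[OF M]) auto
    then show ?thesis using ins loop insert.IH[of C] by simp
  next
    case coloop
    then show ?thesis using ins alt_indep_contract_coloop[OF M insert.hyps(1)] by simp
  next
    case neither
    then have eq: "alt_indep M C (insert e X) = alt_indep M C X - alt_indep M (insert e C) X"
      using ins by simp
    show ?thesis unfolding eq using neither insert.IH[of C] insert.IH[of "insert e C"]
      by (simp add: right_diff_distrib)
  qed
qed

text \<open>The same induction with the roles exchanged: a loop makes the sum zero, and for a coloop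
  the minus sign of the recursion is compensated by the drop in rank under contraction.\<close>

lemma alt_span_sign:
  assumes M: "is_matroid M" and "finite X"
  shows "0 \<le> (- 1) ^ (rk M (C \<union> X) + rk M C) * alt_span M C X"
  using \<open>finite X\<close>
proof (induction X arbitrary: C)
  case empty
  show ?case by (simp add: alt_span_empty)
next
  case (insert e X)
  note ins = alt_span_insert[OF M insert.hyps, of C]
  consider (loop) "rk M (insert e C) = rk M C"
    | (coloop) "rk M (insert e C) = Suc (rk M C)" "rk M (insert e (C \<union> X)) \<noteq> rk M (C \<union> X)"
    | (neither) "rk M (insert e C) = Suc (rk M C)" "rk M (insert e (C \<union> X)) = rk M (C \<union> X)"
    using rk_insert_le[OF M, of e C] rk_mono[OF M, of C "insert e C"]
    by (metis le_SucE le_antisym subset_insertI)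
  then show ?case
  proof cases
    case loop
    then have "rk M (insert e (C \<union> X)) = rk M (C \<union> X)" by (rule rk_insert_eq_mono[OF M]) auto
    then show ?thesis using ins loop alt_span_contract_loop[OF M loop] by simp
  next
    case coloop
    then show ?thesis using ins insert.IH[of "insert e C"] by simp
  next
    case neither
    then have eq: "alt_span M C (insert e X) = alt_span M C X - alt_span M (insert e C) X"
      using ins by simp
    show ?thesis unfolding eq using neither insert.IH[of C] insert.IH[of "insert e C"]
      by (simp add: right_diff_distrib)
  qed
qed

section \<open>The coefficients of the spectrum polynomial\<close>

lemma sum_alternating_Pow:
  assumes "finite X" "X \<noteq> {}"
  shows "(\<Sum>A\<in>Pow X. (- 1 :: int) ^ card A) = 0"
proof -
  obtain e Y where Y: "X = insert e Y" "e \<notin> Y" using assms(2) by (metis Set.set_insert all_not_in_conv)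
  have "card (insert e A) = Suc (card A)" if "A \<subseteq> Y" for A
    using card_insert_subset[OF _ Y(2) that] Y(1) assms(1) by simp
  then have "(\<Sum>A\<in>{A. A \<subseteq> Y \<and> True}. (- 1 :: int) ^ card (insert e A)) = - (\<Sum>A\<in>{A. A \<subseteq> Y \<and> True}. (- 1) ^ card A)"
    unfolding sum_negf[symmetric] by (intro sum.cong) auto
  then show ?thesis
    using sum_subsets_insert[of Y e "\<lambda>A. (- 1) ^ card A" "\<lambda>_. True"] Y assms(1) by (simp add: Pow_def)
qed

section \<open>Closures, flats and the Moebius function\<close>

definition closure_in :: "matroid \<Rightarrow> nat set \<Rightarrow> nat set" where
  "closure_in M A = {x \<in> ground M. rk M (insert x A) = rk M A}"

lemma subset_closure_in: "A \<subseteq> ground M \<Longrightarrow> A \<subseteq> closure_in M A"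
  by (auto simp: closure_in_def insert_absorb)

lemma rk_closure_in:
  assumes M: "is_matroid M" and A: "A \<subseteq> ground M"
  shows "rk M (closure_in M A) = rk M A"
proof -
  have "finite (closure_in M A)" using matroid_finite_ground[OF M] by (simp add: closure_in_def)
  then have "rk M (A \<union> closure_in M A) = rk M A"
    by (rule rk_Un_eq_if_rk_insert_eq[OF M]) (simp add: closure_in_def)
  then show ?thesis using subset_closure_in[OF A] by (simp add: Un_absorb1)
qed

lemma closure_in_flats:
  assumes M: "is_matroid M" and A: "A \<subseteq> ground M"
  shows "closure_in M A \<in> flats M"
proof -
  have "rk M (closure_in M A) < rk M (insert x (closure_in M A))" if "x \<in> ground M - closure_in M A" for x
  proof -
    have "rk M A < rk M (insert x A)"
      using that rk_mono[OF M subset_insertI, of A x] by (auto simp: closure_in_def order.order_iff_strict)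
    also have "\<dots> \<le> rk M (insert x (closure_in M A))"
      using subset_closure_in[OF A] by (intro rk_mono[OF M]) auto
    finally show ?thesis using rk_closure_in[OF M A] by simp
  qed
  then show ?thesis by (auto simp: flats_def closure_in_def)
qed

lemma closure_in_subset_flat:
  assumes M: "is_matroid M" and F: "F \<in> flats M" and "A \<subseteq> F"
  shows "closure_in M A \<subseteq> F"
proof
  fix x assume x: "x \<in> closure_in M A"
  have "rk M (insert x F) = rk M F"
    using rk_insert_eq_mono[OF M _ \<open>A \<subseteq> F\<close>] x by (simp add: closure_in_def)
  then show "x \<in> F" using F x unfolding flats_def closure_in_def by force
qed

text \<open>If \<open>A\<close> has the rank of \<open>F\<close>, inserting any point of
  \<open>F\<close> stays inside \<open>F\<close> and cannot raise the rank. The rank condition is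
  the one in \<open>alt_span\<close>, so its index sets are fibres of the closure map.\<close>

lemma closure_in_eq_iff:
  assumes M: "is_matroid M" and F: "F \<in> flats M" and A: "A \<subseteq> ground M"
  shows "closure_in M A = F \<longleftrightarrow> A \<subseteq> F \<and> rk M A = rk M F"
proof
  assume "closure_in M A = F"
  then show "A \<subseteq> F \<and> rk M A = rk M F" using subset_closure_in[OF A] rk_closure_in[OF M A] by auto
next
  assume *: "A \<subseteq> F \<and> rk M A = rk M F"
  have "x \<in> closure_in M A" if "x \<in> F" for x
  proof -
    have "rk M (insert x A) \<le> rk M F" using that * by (intro rk_mono[OF M]) auto
    moreover have "rk M A \<le> rk M (insert x A)" by (intro rk_mono[OF M]) auto
    ultimately show ?thesis using * that F by (auto simp: closure_in_def flats_def)
  qed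
  then show "closure_in M A = F" using closure_in_subset_flat[OF M F] * by blast
qed

lemma finite_flats: "is_matroid M \<Longrightarrow> finite (flats M)"
  by (rule finite_subset[of _ "Pow (ground M)"]) (auto simp: flats_def matroid_finite_ground)

lemma finite_flat: "is_matroid M \<Longrightarrow> F \<in> flats M \<Longrightarrow> finite F"
  using finite_subset matroid_finite_ground by (auto simp: flats_def)

text \<open>Sorting the sets between \<open>F\<close> and \<open>F \<union> X\<close> by their closure.\<close>

lemma sum_alt_span_flats:
  assumes M: "is_matroid M" and F: "F \<in> flats M" and X: "X \<subseteq> ground M" "X \<inter> F = {}"
    and T: "finite T" "T \<subseteq> flats M" "\<And>H. H \<in> T \<Longrightarrow> F \<subseteq> H \<and> H - F \<subseteq> X \<and> P (rk M H)"
    and closed: "\<And>B. B \<subseteq> X \<Longrightarrow> P (rk M (F \<union> B)) \<Longrightarrow> closure_in M (F \<union> B) \<in> T"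
  shows "(\<Sum>H\<in>T. alt_span M F (H - F)) = (\<Sum>B\<in>{B. B \<subseteq> X \<and> P (rk M (F \<union> B))}. (- 1) ^ card B)"
proof -
  let ?S = "{B. B \<subseteq> X \<and> P (rk M (F \<union> B))}"
  have FX: "F \<union> B \<subseteq> ground M" if "B \<subseteq> X" for B using that F X by (auto simp: flats_def)
  have finS: "finite ?S"
    using finite_subset[OF X(1) matroid_finite_ground[OF M]] by simp
  have "(\<Sum>B\<in>?S. (- 1) ^ card B) = (\<Sum>H\<in>T. \<Sum>B\<in>{B\<in>?S. closure_in M (F \<union> B) = H}. (- 1 :: int) ^ card B)"
    by (rule sum.group[symmetric]) (use finS T(1) closed in auto)
  also have "\<dots> = (\<Sum>H\<in>T. alt_span M F (H - F))"
    unfolding alt_span_def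
  proof (intro sum.cong refl)
    fix H assume H: "H \<in> T"
    have HF: "F \<union> (H - F) = H" using T(3)[OF H] by blast
    have iff: "closure_in M (F \<union> B) = H \<longleftrightarrow> F \<union> B \<subseteq> H \<and> rk M (F \<union> B) = rk M H" if "B \<subseteq> X" for B
      by (rule closure_in_eq_iff[OF M _ FX[OF that]]) (use H T(2) in auto)
    \<comment> \<open>The condition \<open>P\<close> is automatic on the right, because it holds for
      the rank of every \<open>H\<close> in \<open>T\<close>.\<close>
    have "B \<in> ?S \<and> closure_in M (F \<union> B) = H \<longleftrightarrow> B \<subseteq> H - F \<and> rk M (F \<union> B) = rk M H" for B
    proof
      assume *: "B \<in> ?S \<and> closure_in M (F \<union> B) = H"
      then have "B \<subseteq> H" "rk M (F \<union> B) = rk M H" using iff[of B] by auto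
      then show "B \<subseteq> H - F \<and> rk M (F \<union> B) = rk M H" using * X(2) by blast
    next
      assume *: "B \<subseteq> H - F \<and> rk M (F \<union> B) = rk M H"
      moreover from this have "B \<subseteq> X" using T(3)[OF H] by blast
      ultimately show "B \<in> ?S \<and> closure_in M (F \<union> B) = H" using iff[of B] T(3)[OF H] by auto
    qed
    then show "{B\<in>?S. closure_in M (F \<union> B) = H} = {B. B \<subseteq> H - F \<and> rk M (F \<union> B) = rk M (F \<union> (H - F))}"
      unfolding HF by blast
  qed
  finally show ?thesis by simp
qed

text \<open>By the closure sorting, the sum of \<open>alt_span\<close> over all flats between
  \<open>F\<close> and \<open>G\<close> is the alternating sum over all subsets of
  \<open>G - F\<close>, which vanishes unless \<open>F = G\<close>. This is the recursion defining
  the Moebius function.\<close>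

lemma moebius_flats_eq_alt_span:
  assumes M: "is_matroid M" and F: "F \<in> flats M"
  shows "G \<in> flats M \<Longrightarrow> F \<subseteq> G \<Longrightarrow> moebius (flats M) F G = alt_span M F (G - F)"
proof (induction "card G" arbitrary: G rule: less_induct)
  case less
  note G = less.prems
  have finG: "finite G" using finite_flat[OF M G(1)] .
  show ?case
  proof (cases "F = G")
    case True
    then show ?thesis by (simp add: moebius.simps alt_span_empty)
  next
    case False
    let ?T = "{H \<in> flats M. F \<subseteq> H \<and> H \<subset> G}"
    have T: "{H \<in> flats M. F \<subseteq> H \<and> H \<subseteq> G} = insert G ?T" using G by auto
    have finT: "finite ?T" using finite_flats[OF M] by simp
    have "0 = (\<Sum>B\<in>{B. B \<subseteq> G - F \<and> True}. (- 1 :: int) ^ card B)"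
      using sum_alternating_Pow[of "G - F"] finG G False by (auto simp: Pow_def)
    also have "\<dots> = (\<Sum>H\<in>{H \<in> flats M. F \<subseteq> H \<and> H \<subseteq> G}. alt_span M F (H - F))"
    proof (rule sum_alt_span_flats[OF M F, symmetric, where P = "\<lambda>_. True"])
      show "G - F \<subseteq> ground M" using G(1) by (auto simp: flats_def)
      show "closure_in M (F \<union> B) \<in> {H \<in> flats M. F \<subseteq> H \<and> H \<subseteq> G}" if "B \<subseteq> G - F" for B
      proof -
        have sub: "F \<union> B \<subseteq> G" using that G by auto
        then have "F \<union> B \<subseteq> ground M" using G(1) by (auto simp: flats_def)
        then show ?thesis
          using closure_in_subset_flat[OF M G(1) sub] subset_closure_in closure_in_flats[OF M] by blast
      qed
    qed (use finite_flats[OF M] in auto)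
    also have "\<dots> = alt_span M F (G - F) + (\<Sum>H\<in>?T. alt_span M F (H - F))"
      unfolding T by (rule sum.insert[OF finT]) simp
    also have "(\<Sum>H\<in>?T. alt_span M F (H - F)) = (\<Sum>H\<in>?T. moebius (flats M) F H)"
      by (intro sum.cong refl less.hyps[symmetric]) (auto intro: psubset_card_mono[OF finG])
    finally show ?thesis using False G finG by (subst moebius.simps) auto
  qed
qed

section \<open>Removing the absolute values and extending the sum to all sets\<close>

lemma reduced_euler_char_restrict:
  "reduced_euler_char (indep (restrict_matroid M F))
    = - (\<Sum>I\<in>{I \<in> indep M. I \<subseteq> F}. (- 1) ^ card I)"
  by (simp add: reduced_euler_char_def restrict_matroid_def sum_negf)

lemma abs_eq_sign_power_mult: "0 \<le> (- 1) ^ n * x \<Longrightarrow> \<bar>x\<bar> = (- 1) ^ n * (x :: int)"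
  by (cases "even n") auto

lemma alt_indep_empty:
  assumes M: "is_matroid M" and "finite F"
  shows "alt_indep M {} F = (\<Sum>I\<in>{I \<in> indep M. I \<subseteq> F}. (- 1) ^ card I)"
  unfolding alt_indep_def using assms rk_empty[OF M] indep_iff_rk[OF M] finite_subset
  by (intro sum.cong) (auto dest: finite_subset)

text \<open>The factors \<open>(- 1) ^ rk M F\<close> from the two sign lemmas cancel. The remaining
  sign depends only on \<open>rk M G\<close>, so it is constant for a fixed power of
  \<open>t\<close>.\<close>

lemma abs_euler_char_mult_abs_moebius:
  assumes M: "is_matroid M" and F: "F \<in> flats M" and G: "G \<in> flats M" "F \<subseteq> G"
  shows "\<bar>reduced_euler_char (indep (restrict_matroid M F))\<bar> * \<bar>moebius (flats M) F G\<bar>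
    = (- 1) ^ rk M G * (\<Sum>I\<in>{I \<in> indep M. I \<subseteq> F}. (- 1) ^ card I) * alt_span M F (G - F)"
proof -
  have fin: "finite F" "finite (G - F)" using finite_flat[OF M] F G by auto
  have "\<bar>alt_indep M {} F\<bar> = (- 1) ^ rk M F * alt_indep M {} F"
    using alt_indep_sign[OF M fin(1), of "{}"] rk_empty[OF M] by (intro abs_eq_sign_power_mult) simp
  moreover have "\<bar>alt_span M F (G - F)\<bar> = (- 1) ^ (rk M G + rk M F) * alt_span M F (G - F)"
    using alt_span_sign[OF M fin(2), of F] G(2) by (intro abs_eq_sign_power_mult) (simp add: Un_absorb1)
  ultimately have "\<bar>alt_indep M {} F\<bar> * \<bar>alt_span M F (G - F)\<bar>
      = ((- 1) ^ rk M F * (- 1) ^ rk M F) * (- 1) ^ rk M G * alt_indep M {} F * alt_span M F (G - F)"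
    by (simp only: power_add mult.assoc mult.commute mult.left_commute)
  then show ?thesis
    using moebius_flats_eq_alt_span[OF M F G] reduced_euler_char_restrict[of M F] alt_indep_empty[OF M fin(1)]
    by (simp flip: power_add)
qed

text \<open>For a flat \<open>S\<close>, sort by closure. Otherwise some \<open>e\<close> outside
  \<open>S\<close> does not raise its rank, and pairing \<open>B\<close> with
  \<open>insert e B\<close> cancels everything. This lets a sum over flats run over all subsets of
  the ground set.\<close>

lemma sum_alternating_rk_eq:
  assumes M: "is_matroid M" and S: "S \<subseteq> ground M"
  shows "(\<Sum>B\<in>{B. B \<subseteq> ground M - S \<and> rk M (S \<union> B) = k}. (- 1) ^ card B)
    = (if S \<in> flats M then \<Sum>G\<in>{G \<in> flats M. S \<subseteq> G \<and> rk M G = k}. alt_span M S (G - S) else 0)"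
proof (cases "S \<in> flats M")
  case True
  have "(\<Sum>G\<in>{G \<in> flats M. S \<subseteq> G \<and> rk M G = k}. alt_span M S (G - S))
      = (\<Sum>B\<in>{B. B \<subseteq> ground M - S \<and> rk M (S \<union> B) = k}. (- 1) ^ card B)"
  proof (rule sum_alt_span_flats[OF M True])
    fix B assume B: "B \<subseteq> ground M - S" "rk M (S \<union> B) = k"
    then have "S \<union> B \<subseteq> ground M" using S by auto
    then show "closure_in M (S \<union> B) \<in> {G \<in> flats M. S \<subseteq> G \<and> rk M G = k}"
      using closure_in_flats[OF M] subset_closure_in rk_closure_in[OF M] B(2) by blast
  next
    show "finite {G \<in> flats M. S \<subseteq> G \<and> rk M G = k}" using finite_flats[OF M] by simp
  qed (auto simp: flats_def)
  then show ?thesis using True by simp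
next
  case False
  then obtain e where e: "e \<in> ground M - S" "\<not> rk M S < rk M (insert e S)"
    using S by (auto simp: flats_def)
  then have eq: "rk M (insert e S) = rk M S" using rk_mono[OF M subset_insertI, of S e] by simp
  define X where "X = ground M - S - {e}"
  have X: "ground M - S = insert e X" "finite X" "e \<notin> X"
    using e matroid_finite_ground[OF M] by (auto simp: X_def)
  have "rk M (S \<union> insert e B) = rk M (S \<union> B)" for B
    using rk_insert_eq_mono[OF M eq, of "S \<union> B"] by simp
  moreover have "card (insert e B) = Suc (card B)" if "B \<subseteq> X" for B
    using card_insert_subset[OF X(2,3) that] .
  then have "(\<Sum>B\<in>{B. B \<subseteq> X \<and> rk M (S \<union> B) = k}. (- 1 :: int) ^ card (insert e B))
      = - (\<Sum>B\<in>{B. B \<subseteq> X \<and> rk M (S \<union> B) = k}. (- 1) ^ card B)"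
    unfolding sum_negf[symmetric] by (intro sum.cong) auto
  ultimately show ?thesis
    using False sum_subsets_insert[OF X(2,3), of "\<lambda>B. (- 1) ^ card B" "\<lambda>B. rk M (S \<union> B) = k"] X(1)
    by simp
qed

text \<open>The point of this form is that the index set depends on \<open>M\<close> only through
  \<open>ground M\<close>; the rest of the matroid enters only through the condition under
  \<open>of_bool\<close>.\<close>

lemma coeff_Spec:
  assumes M: "is_matroid M"
  shows "coeff (coeff (Spec M) j) k
    = (\<Sum>(S, B, I)\<in>(SIGMA S:{S. S \<subseteq> ground M \<and> card S = j}. Pow (ground M - S) \<times> Pow S).
        (- 1) ^ (k + card B + card I) * of_bool (I \<in> indep M \<and> rk M (S \<union> B) = k))"
proof -
  let ?E = "ground M"
  let ?\<chi> = "\<lambda>S. \<Sum>I\<in>{I \<in> indep M. I \<subseteq> S}. (- 1 :: int) ^ card I"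
  let ?\<mu> = "\<lambda>S. \<Sum>B\<in>{B. B \<subseteq> ?E - S \<and> rk M (S \<union> B) = k}. (- 1 :: int) ^ card B"
  let ?T = "\<lambda>F. {G \<in> flats M. F \<subseteq> G \<and> rk M G = k}"
  have fin: "finite ?E" "finite (flats M)" using matroid_finite_ground[OF M] finite_flats[OF M] by auto
  define c where "c = (\<lambda>F G. \<bar>reduced_euler_char (indep (restrict_matroid M F))\<bar> * \<bar>moebius (flats M) F G\<bar>)"
  have c: "c F G = (- 1) ^ k * ?\<chi> F * alt_span M F (G - F)" if "F \<in> flats M" "G \<in> ?T F" for F G
    using abs_euler_char_mult_abs_moebius[OF M that(1), of G] that(2) by (auto simp: c_def)
  have "coeff (coeff (Spec M) j) k
      = (\<Sum>(F, G)\<in>{(F, G). F \<in> flats M \<and> G \<in> flats M \<and> F \<subseteq> G}. if card F = j \<and> rk M G = k then c F G else 0)"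
    unfolding Spec_def coeff_sum by (intro sum.cong refl) (auto simp: c_def)
  also have "\<dots> = (\<Sum>(F, G)\<in>(SIGMA F:{F \<in> flats M. card F = j}. ?T F). c F G)"
  proof (rule sum.mono_neutral_cong_right)
    show "finite {(F, G). F \<in> flats M \<and> G \<in> flats M \<and> F \<subseteq> G}"
      by (rule finite_subset[of _ "flats M \<times> flats M"]) (use fin in auto)
  qed (auto split: if_splits)
  also have "\<dots> = (\<Sum>F\<in>{F \<in> flats M. card F = j}. \<Sum>G\<in>?T F. c F G)"
    using fin by (subst sum.Sigma) auto
  also have "\<dots> = (\<Sum>F\<in>{F \<in> flats M. card F = j}. \<Sum>G\<in>?T F. (- 1) ^ k * ?\<chi> F * alt_span M F (G - F))"
    by (intro sum.cong refl c) auto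
  \<comment> \<open>For a flat, the inner sum over flats above it is the alternating count
    \<open>?\<mu>\<close>.\<close>
  also have "\<dots> = (\<Sum>F\<in>{F \<in> flats M. card F = j}. (- 1) ^ k * ?\<chi> F * ?\<mu> F)"
    by (intro sum.cong refl) (auto simp: sum_alternating_rk_eq[OF M] flats_def sum_distrib_left)
  \<comment> \<open>The added sets \<open>S\<close> are not flats, so \<open>?\<mu> S\<close> is
    zero for them.\<close>
  also have "\<dots> = (\<Sum>S\<in>{S. S \<subseteq> ?E \<and> card S = j}. (- 1) ^ k * ?\<chi> S * ?\<mu> S)"
    by (rule sum.mono_neutral_left) (use fin in \<open>auto simp: sum_alternating_rk_eq[OF M] flats_def\<close>)
  also have "\<dots> = (\<Sum>S\<in>{S. S \<subseteq> ?E \<and> card S = j}. \<Sum>(B, I)\<in>Pow (?E - S) \<times> Pow S.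
        (- 1) ^ (k + card B + card I) * of_bool (I \<in> indep M \<and> rk M (S \<union> B) = k))"
  proof (intro sum.cong refl)
    fix S assume S: "S \<in> {S. S \<subseteq> ?E \<and> card S = j}"
    then have finS: "finite (Pow S)" "finite (Pow (?E - S))" using fin finite_subset by auto
    have \<chi>: "?\<chi> S = (\<Sum>I\<in>Pow S. (- 1) ^ card I * of_bool (I \<in> indep M))"
      using finS by (intro sum.mono_neutral_cong_left) auto
    have \<mu>: "?\<mu> S = (\<Sum>B\<in>Pow (?E - S). (- 1) ^ card B * of_bool (rk M (S \<union> B) = k))"
      using finS by (intro sum.mono_neutral_cong_left) auto
    have "(- 1) ^ k * ?\<chi> S * ?\<mu> S = (- 1) ^ k * (?\<mu> S * ?\<chi> S)" by simp
    also have "\<dots> = (\<Sum>(B, I)\<in>Pow (?E - S) \<times> Pow S. (- 1) ^ k *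
        (((- 1) ^ card B * of_bool (rk M (S \<union> B) = k)) * ((- 1) ^ card I * of_bool (I \<in> indep M))))"
      unfolding \<chi> \<mu> unfolding sum_product unfolding sum.cartesian_product
      by (simp add: sum_distrib_left case_prod_unfold)
    also have "\<dots> = (\<Sum>(B, I)\<in>Pow (?E - S) \<times> Pow S.
        (- 1) ^ (k + card B + card I) * of_bool (I \<in> indep M \<and> rk M (S \<union> B) = k))"
      by (intro sum.cong refl) (auto simp: power_add)
    finally show "(- 1) ^ k * ?\<chi> S * ?\<mu> S = \<dots>" .
  qed
  also have "\<dots> = (\<Sum>(S, B, I)\<in>(SIGMA S:{S. S \<subseteq> ?E \<and> card S = j}. Pow (?E - S) \<times> Pow S).
        (- 1) ^ (k + card B + card I) * of_bool (I \<in> indep M \<and> rk M (S \<union> B) = k))"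
    using fin finite_subset by (subst sum.Sigma) (auto simp: case_prod_unfold)
  finally show ?thesis .
qed

section \<open>Valuativity and invariance\<close>

lemma lookup_scaleR: "Poly_Mapping.lookup (c *\<^sub>R x) e = c *\<^sub>R Poly_Mapping.lookup x e"
proof -
  have "finite {i. c *\<^sub>R Poly_Mapping.lookup x i \<noteq> 0}"
    by (rule finite_subset[of _ "Poly_Mapping.keys x"]) (auto simp: in_keys_iff)
  then show ?thesis by (simp add: scaleR_poly_mapping_def)
qed

text \<open>The norm of a finitely supported function is the sum of the norms of its coordinates, so
  it dominates each of them.\<close>

lemma bounded_linear_lookup:
  "bounded_linear (\<lambda>x :: 'a \<Rightarrow>\<^sub>0 'b::real_normed_vector. Poly_Mapping.lookup x e)"
proof (rule bounded_linear_intro[where K = 1])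
  fix x :: "'a \<Rightarrow>\<^sub>0 'b"
  show "norm (Poly_Mapping.lookup x e) \<le> norm x * 1"
  proof (cases "e \<in> Poly_Mapping.keys x")
    case True
    have "norm (Poly_Mapping.lookup x e) \<le> (\<Sum>i\<in>Poly_Mapping.keys x. norm (Poly_Mapping.lookup x i))"
      using True by (intro member_le_sum) auto
    then show ?thesis by (simp add: norm_poly_mapping_def dist_poly_mapping_def)
  qed (simp add: in_keys_iff)
qed (simp_all add: lookup_add lookup_scaleR)

lemma bounded_linear_sum_lookup:
  "bounded_linear (\<lambda>x :: 'a \<Rightarrow>\<^sub>0 'b::real_normed_vector. \<Sum>e\<in>A. Poly_Mapping.lookup x e)"
  by (intro bounded_linear_sum bounded_linear_lookup)

lemma sum_lookup_indicator:
  assumes "finite A" "finite B"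
  shows "(\<Sum>e\<in>A. Poly_Mapping.lookup (\<Sum>i\<in>B. Poly_Mapping.single i (1::real)) e) = real (card (A \<inter> B))"
proof -
  have "(\<Sum>e\<in>A. Poly_Mapping.lookup (\<Sum>i\<in>B. Poly_Mapping.single i (1::real)) e)
      = (\<Sum>e\<in>A. of_bool (e \<in> B))"
    using assms by (intro sum.cong refl) (simp add: lookup_sum lookup_single when_def)
  then show ?thesis using assms by simp
qed

lemma basesI:
  assumes M: "is_matroid M" and B: "B \<in> indep M" "card B = rk M (ground M)"
  shows "B \<in> bases M"
proof -
  have "I = B" if I: "I \<in> indep M" "B \<subseteq> I" for I
  proof -
    have "card I \<le> card B"
      using card_le_rk[OF M I(1) matroid_indep_subset_ground[OF M I(1)]] B(2) by simp
    then show ?thesis using card_seteq[OF matroid_finite_indep[OF M I(1)] I(2)] by simp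
  qed
  then show ?thesis using B(1) by (auto simp: bases_def)
qed

lemma compact_base_polytope:
  assumes M: "is_matroid M"
  shows "compact (base_polytope M)"
proof -
  have "finite (bases M)"
    by (rule finite_subset[OF _ matroid_finite_indeps[OF M]]) (auto simp: bases_def)
  then show ?thesis unfolding base_polytope_def by (intro finite_imp_compact_convex_hull) simp
qed

text \<open>A relation between indicators is given only on \<open>coord_space\<close>; this
  inclusion extends it to all points and shows that points of the polytopes are determined by their
  coordinates in the ground set.\<close>

lemma base_polytope_subset_coord_space:
  assumes M: "is_matroid M"
  shows "base_polytope M \<subseteq> coord_space (ground M)"
  unfolding base_polytope_def
proof (rule hull_minimal)
  show "convex (coord_space (ground M))"
  proof (rule convexI)
    fix x y :: "nat \<Rightarrow>\<^sub>0 real" and u v :: real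
    assume "x \<in> coord_space (ground M)" "y \<in> coord_space (ground M)"
    moreover have "Poly_Mapping.keys (u *\<^sub>R x + v *\<^sub>R y) \<subseteq> Poly_Mapping.keys x \<union> Poly_Mapping.keys y"
      by (auto simp: in_keys_iff lookup_add lookup_scaleR)
    ultimately show "u *\<^sub>R x + v *\<^sub>R y \<in> coord_space (ground M)" by (auto simp: coord_space_def)
  qed
  show "(\<lambda>B. \<Sum>i\<in>B. Poly_Mapping.single i 1) ` bases M \<subseteq> coord_space (ground M)"
  proof clarify
    fix B assume "B \<in> bases M"
    then have "B \<in> indep M" by (simp add: bases_def)
    then have "B \<subseteq> ground M" "finite B"
      using matroid_indep_subset_ground[OF M] matroid_finite_indep[OF M] by auto
    then show "(\<Sum>i\<in>B. Poly_Mapping.single i 1) \<in> coord_space (ground M)"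
      by (auto simp: coord_space_def in_keys_iff lookup_sum lookup_single when_def split: if_splits)
  qed
qed

text \<open>The inequality defines a convex set, so it suffices to check vertices, where the left
  side is \<open>card (A \<inter> B)\<close> with \<open>A \<inter> B\<close> independent.\<close>

lemma base_polytope_sum_le_rk:
  assumes M: "is_matroid M" and A: "finite A" and x: "x \<in> base_polytope M"
  shows "(\<Sum>e\<in>A. Poly_Mapping.lookup x e) \<le> real (rk M A)"
proof -
  let ?f = "\<lambda>x :: nat \<Rightarrow>\<^sub>0 real. \<Sum>e\<in>A. Poly_Mapping.lookup x e"
  have "base_polytope M \<subseteq> ?f -` {..real (rk M A)}"
    unfolding base_polytope_def
  proof (rule hull_minimal)
    show "convex (?f -` {..real (rk M A)})"
      by (intro convex_linear_vimage bounded_linear.linear bounded_linear_sum_lookup) simp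
    show "(\<lambda>B. \<Sum>i\<in>B. Poly_Mapping.single i 1) ` bases M \<subseteq> ?f -` {..real (rk M A)}"
    proof clarify
      fix B assume "B \<in> bases M"
      then have B: "B \<in> indep M" by (simp add: bases_def)
      then have "A \<inter> B \<in> indep M" using matroid_indep_mono[OF M] by blast
      then have "card (A \<inter> B) \<le> rk M A" by (rule card_le_rk[OF M]) simp
      then show "(\<Sum>i\<in>B. Poly_Mapping.single i 1) \<in> ?f -` {..real (rk M A)}"
        using sum_lookup_indicator[OF A matroid_finite_indep[OF M B]] by simp
    qed
  qed
  then show ?thesis using x by auto
qed

text \<open>A flag \<open>I \<subseteq> A\<close> is adapted to some basis, so that the half-spaces belonging to \<open>I\<close> and
  \<open>A\<close> meet the base polytope together as soon as they do so separately.\<close>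

lemma base_polytope_Int_halfspaces_nonempty_iff:
  assumes M: "is_matroid M" and IA: "I \<subseteq> A" "A \<subseteq> ground M"
  shows "base_polytope M \<inter> {x. real (card I) \<le> (\<Sum>e\<in>I. Poly_Mapping.lookup x e)}
        \<inter> {x. real k \<le> (\<Sum>e\<in>A. Poly_Mapping.lookup x e)} \<noteq> {}
    \<longleftrightarrow> I \<in> indep M \<and> k \<le> rk M A" (is "?P \<noteq> {} \<longleftrightarrow> _")
proof
  have fin: "finite A" "finite I"
    using finite_subset[OF IA(2) matroid_finite_ground[OF M]] finite_subset[OF IA(1)] by auto
  {
    assume "?P \<noteq> {}"
    then obtain x where x: "x \<in> base_polytope M" "real (card I) \<le> (\<Sum>e\<in>I. Poly_Mapping.lookup x e)"
        "real k \<le> (\<Sum>e\<in>A. Poly_Mapping.lookup x e)" by blast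
    have "card I \<le> rk M I" "k \<le> rk M A"
      using base_polytope_sum_le_rk[OF M fin(2) x(1)] base_polytope_sum_le_rk[OF M fin(1) x(1)] x(2,3)
      by linarith+
    moreover have "rk M I \<le> card I"
      using rk_Un_le[OF M fin(2), of "{}"] rk_empty[OF M] by simp
    ultimately show "I \<in> indep M \<and> k \<le> rk M A" using indep_iff_rk[OF M fin(2)] by simp
  next
    assume I: "I \<in> indep M \<and> k \<le> rk M A"
    \<comment> \<open>Extending \<open>I\<close> first inside \<open>A\<close> and then to a basis
      \<open>B\<close> gives a vertex satisfying both inequalities: \<open>B\<close> contains
      \<open>I\<close> and has at least \<open>rk M A\<close> elements in \<open>A\<close>.\<close>
    obtain J where J: "J \<in> indep M" "I \<subseteq> J" "J \<subseteq> A" "card J = rk M A"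
      using indep_extends_to_rk[OF M _ IA(1)] I by blast
    have "J \<subseteq> ground M" using J(3) IA(2) by (rule order_trans)
    then obtain B where B: "B \<in> indep M" "J \<subseteq> B" "B \<subseteq> ground M" "card B = rk M (ground M)"
      by (rule indep_extends_to_rk[OF M J(1)])
    have finB: "finite B" using matroid_finite_indep[OF M B(1)] .
    let ?x = "\<Sum>i\<in>B. Poly_Mapping.single i (1::real)"
    have "?x \<in> base_polytope M"
      unfolding base_polytope_def using basesI[OF M B(1,4)] by (intro hull_inc) auto
    moreover have "I \<inter> B = I" using J(2) B(2) by blast
    then have "real (card I) \<le> (\<Sum>e\<in>I. Poly_Mapping.lookup ?x e)"
      using sum_lookup_indicator[OF fin(2) finB] by simp
    moreover have "card J \<le> card (A \<inter> B)" using J(3) B(2) fin by (intro card_mono) auto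
    then have "real k \<le> (\<Sum>e\<in>A. Poly_Mapping.lookup ?x e)"
      using sum_lookup_indicator[OF fin(1) finB] J(4) I by simp
    ultimately show "?P \<noteq> {}" by blast
  }
qed

text \<open>Cutting all polytopes by the same half-spaces preserves the relation between indicators,
  and nonemptiness of the cut polytopes expresses the matroid condition.\<close>

lemma sum_indep_rk_eq_0:
  fixes a :: "nat \<Rightarrow> int"
  assumes M: "\<And>i. i < s \<Longrightarrow> is_matroid (M i) \<and> ground (M i) = E"
    and zero: "\<And>x. x \<in> coord_space E \<Longrightarrow> (\<Sum>i<s. a i * indicator (base_polytope (M i)) x) = 0"
    and IA: "I \<subseteq> A" "A \<subseteq> E"
  shows "(\<Sum>i<s. a i * of_bool (I \<in> indep (M i) \<and> rk (M i) A = k)) = 0"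
\<comment> \<open>\<open>E\<close> is known to be finite only when some matroid lives on it.\<close>
proof (cases "s = 0")
  case False
  then have finE: "finite E" using M[of 0] matroid_finite_ground by auto
  let ?P = "\<lambda>i. base_polytope (M i)"
  let ?H = "\<lambda>S c. {x :: nat \<Rightarrow>\<^sub>0 real. real c \<le> (\<Sum>e\<in>S. Poly_Mapping.lookup x e)}"
  have H: "closed (?H S c)" "convex (?H S c)" for S c
  proof -
    have eq: "?H S c = (\<lambda>x. \<Sum>e\<in>S. Poly_Mapping.lookup x e) -` {real c..}" by auto
    show "closed (?H S c)" unfolding eq
      by (intro continuous_closed_vimage) (auto intro: linear_continuous_at bounded_linear_sum_lookup)
    show "convex (?H S c)" unfolding eq
      by (intro convex_linear_vimage bounded_linear.linear bounded_linear_sum_lookup) simp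
  qed
  have out: "x \<in> coord_space E" if "i < s" "x \<in> ?P i" for i x
    using base_polytope_subset_coord_space[of "M i"] M[OF that(1)] that(2) by auto
  have zero': "(\<Sum>i<s. a i * of_bool (x \<in> ?P i)) = 0" for x
  proof (cases "x \<in> coord_space E")
    case True
    then show ?thesis using zero[of x] by (simp add: indicator_def of_bool_def)
  next
    case False
    then show ?thesis using out by (intro sum.neutral) auto
  qed
  have ge: "(\<Sum>i<s. a i * of_bool (I \<in> indep (M i) \<and> c \<le> rk (M i) A)) = 0" for c
  proof -
    have "(\<Sum>i<s. a i * of_bool (?P i \<inter> ?H I (card I) \<inter> ?H A c \<noteq> {})) = 0"
    proof (rule sum_nonempty_eq_0_if_sum_indicator_eq_0)
      \<comment> \<open>The finitely many coordinates in \<open>E\<close> serve as the separating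
        functionals.\<close>
      show "finite ((\<lambda>e x. Poly_Mapping.lookup x e) ` E)" using finE by simp
      show "compact (?P i \<inter> ?H I (card I) \<inter> ?H A c)" if "i \<in> {..<s}" for i
        using that M compact_base_polytope H(1) by (auto intro!: compact_Int_closed)
      show "convex (?P i \<inter> ?H I (card I) \<inter> ?H A c)" for i
        using H(2) by (intro convex_Int) (auto simp: base_polytope_def)
      fix x show "(\<Sum>i<s. a i * of_bool (x \<in> ?P i \<inter> ?H I (card I) \<inter> ?H A c)) = 0"
      proof (cases "x \<in> ?H I (card I) \<inter> ?H A c")
        case True
        then show ?thesis using zero'[of x] by simp
      next
        case False
        then show ?thesis by (intro sum.neutral) auto
      qed
    next
      fix i j x y
      assume "i \<in> {..<s}" "j \<in> {..<s}" "x \<in> ?P i \<inter> ?H I (card I) \<inter> ?H A c"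
        "y \<in> ?P j \<inter> ?H I (card I) \<inter> ?H A c"
        and eq: "\<forall>f\<in>(\<lambda>e x. Poly_Mapping.lookup x e) ` E. f x = f y"
      then have "x \<in> coord_space E" "y \<in> coord_space E" using out by auto
      then have "Poly_Mapping.lookup x e = Poly_Mapping.lookup y e" for e
        using eq by (cases "e \<in> E") (auto simp: coord_space_def in_keys_iff subset_iff dest!: spec[of _ e])
      then show "x = y" by (rule poly_mapping_eqI)
    qed (auto intro: bounded_linear_lookup)
    moreover have "?P i \<inter> ?H I (card I) \<inter> ?H A c \<noteq> {} \<longleftrightarrow> I \<in> indep (M i) \<and> c \<le> rk (M i) A"
      if "i < s" for i
      using base_polytope_Int_halfspaces_nonempty_iff[of "M i" I A c] M[OF that] IA by simp
    ultimately show ?thesis by (simp cong: sum.cong_simp)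
  qed
  \<comment> \<open>Rank exactly \<open>k\<close> is the difference of rank at least
    \<open>k\<close> and rank at least \<open>Suc k\<close>.\<close>
  have "(\<Sum>i<s. a i * of_bool (I \<in> indep (M i) \<and> rk (M i) A = k))
      = (\<Sum>i<s. a i * of_bool (I \<in> indep (M i) \<and> k \<le> rk (M i) A)
          - a i * of_bool (I \<in> indep (M i) \<and> Suc k \<le> rk (M i) A))"
    by (intro sum.cong refl) (auto simp: of_bool_def)
  also have "\<dots> = 0" using ge[of k] ge[of "Suc k"] by (simp only: sum_subtractf)
  finally show ?thesis .
qed simp

section \<open>Valuativity, coefficient by coefficient\<close>

lemma int_scale_eq: "int_scale c (p :: 'a::comm_ring_1) = of_int c * p"
  by (simp add: int_scale_def)

lemma valuation_Spec: "valuation Spec"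
  unfolding valuation_def
proof (intro allI impI)
  fix E s and M :: "nat \<Rightarrow> matroid" and a :: "nat \<Rightarrow> int"
  assume M: "\<forall>i<s. is_matroid (M i) \<and> ground (M i) = E"
    and zero: "\<forall>x\<in>coord_space E. (\<Sum>i<s. a i * indicator (base_polytope (M i)) x) = 0"
  have "coeff (coeff (\<Sum>i<s. int_scale (a i) (Spec (M i))) j) k = 0" for j k
  proof -
    let ?T = "SIGMA S:{S. S \<subseteq> E \<and> card S = j}. Pow (E - S) \<times> Pow S"
    let ?g = "\<lambda>i S B I. of_bool (I \<in> indep (M i) \<and> rk (M i) (S \<union> B) = k) :: int"
    have "coeff (coeff (\<Sum>i<s. int_scale (a i) (Spec (M i))) j) k = (\<Sum>i<s. a i * coeff (coeff (Spec (M i)) j) k)"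
      by (simp add: int_scale_eq coeff_sum of_int_poly)
    \<comment> \<open>All \<open>M i\<close> share the ground set \<open>E\<close> and hence the
      index set \<open>?T\<close>, so the two sums can be exchanged.\<close>
    also have "\<dots> = (\<Sum>i<s. \<Sum>(S, B, I)\<in>?T. (- 1) ^ (k + card B + card I) * (a i * ?g i S B I))"
      using M by (intro sum.cong refl) (simp add: coeff_Spec sum_distrib_left case_prod_unfold mult.left_commute)
    also have "\<dots> = (\<Sum>(S, B, I)\<in>?T. (- 1) ^ (k + card B + card I) * (\<Sum>i<s. a i * ?g i S B I))"
      unfolding case_prod_unfold sum_distrib_left by (rule sum.swap)
    also have "\<dots> = 0"
    proof (intro sum.neutral ballI)
      fix t assume "t \<in> ?T"
      then obtain S B I where t: "t = (S, B, I)" "S \<subseteq> E" "B \<subseteq> E - S" "I \<subseteq> S" by auto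
      then have IA: "I \<subseteq> S \<union> B" "S \<union> B \<subseteq> E" by auto
      have "(\<Sum>i<s. a i * ?g i S B I) = 0"
        by (rule sum_indep_rk_eq_0[of s M E a]) (use M zero IA in auto)
      then show "(case t of (S, B, I) \<Rightarrow> (- 1) ^ (k + card B + card I) * (\<Sum>i<s. a i * ?g i S B I)) = 0"
        using t(1) by simp
    qed
    finally show ?thesis .
  qed
  then show "(\<Sum>i<s. int_scale (a i) (Spec (M i))) = 0" by (simp add: poly_eq_iff)
qed

section \<open>Invariance under isomorphism\<close>

lemma matroid_iso_rk:
  assumes M: "is_matroid M" and N: "is_matroid N" and \<phi>: "bij_betw \<phi> (ground M) (ground N)"
    and ind: "\<And>I. I \<subseteq> ground M \<Longrightarrow> I \<in> indep M \<longleftrightarrow> \<phi> ` I \<in> indep N" and A: "A \<subseteq> ground M"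
  shows "rk N (\<phi> ` A) = rk M A"
proof (rule antisym)
  have inj: "inj_on \<phi> A" using \<phi> A by (auto simp: bij_betw_def intro: inj_on_subset)
  obtain J where J: "J \<in> indep N" "J \<subseteq> \<phi> ` A" "card J = rk N (\<phi> ` A)" using rk_attained[OF N] .
  obtain I where I: "I \<subseteq> A" "J = \<phi> ` I" using J(2) by (auto simp: subset_image_iff)
  have "card J = card I" unfolding I(2) by (rule card_image[OF inj_on_subset[OF inj I(1)]])
  then show "rk N (\<phi> ` A) \<le> rk M A"
    using card_le_rk[OF M, of I A] ind[of I] J I A by auto
  obtain K where K: "K \<in> indep M" "K \<subseteq> A" "card K = rk M A" using rk_attained[OF M] .
  have "card (\<phi> ` K) = card K" by (rule card_image[OF inj_on_subset[OF inj K(2)]])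
  then show "rk M A \<le> rk N (\<phi> ` A)"
    using card_le_rk[OF N, of "\<phi> ` K" "\<phi> ` A"] ind[of K] K A by auto
qed

text \<open>Taking images under the isomorphism is a bijection between the triples indexing the
  coefficients of \<open>M\<close> and \<open>N\<close>, and it preserves cardinality, independence
  and rank.\<close>

lemma Spec_iso:
  assumes M: "is_matroid M" and N: "is_matroid N" and iso: "matroid_iso M N"
  shows "Spec M = Spec N"
proof -
  obtain \<phi> where \<phi>: "bij_betw \<phi> (ground M) (ground N)"
    and ind: "\<And>I. I \<subseteq> ground M \<Longrightarrow> I \<in> indep M \<longleftrightarrow> \<phi> ` I \<in> indep N"
    using iso by (auto simp: matroid_iso_def)
  define \<psi> where "\<psi> = inv_into (ground M) \<phi>"
  have inj: "inj_on \<phi> (ground M)" and im: "\<phi> ` ground M = ground N" using \<phi> by (auto simp: bij_betw_def)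
  have \<psi>: "bij_betw \<psi> (ground N) (ground M)" unfolding \<psi>_def by (rule bij_betw_inv_into[OF \<phi>])
  have injN: "inj_on \<psi> (ground N)" and imN: "\<psi> ` ground N = ground M" using \<psi> by (auto simp: bij_betw_def)
  have \<psi>\<phi>: "\<psi> ` \<phi> ` A = A" if "A \<subseteq> ground M" for A
    unfolding \<psi>_def using inv_into_image_cancel[OF inj that] .
  have \<phi>\<psi>: "\<phi> ` \<psi> ` A = A" if "A \<subseteq> ground N" for A
    unfolding \<psi>_def using image_inv_into_cancel[OF im that] .
  have card\<phi>: "card (\<phi> ` A) = card A" if "A \<subseteq> ground M" for A
    by (rule card_image[OF inj_on_subset[OF inj that]])
  have card\<psi>: "card (\<psi> ` A) = card A" if "A \<subseteq> ground N" for A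
    by (rule card_image[OF inj_on_subset[OF injN that]])
  \<comment> \<open>Injectivity keeps the images of \<open>B\<close> and \<open>S\<close>
    disjoint.\<close>
  have diff\<phi>: "\<phi> ` B \<subseteq> ground N - \<phi> ` S" if "S \<subseteq> ground M" "B \<subseteq> ground M - S" for S B
    using image_mono[OF that(2), of \<phi>] inj_on_image_set_diff[OF inj Diff_subset that(1)] im by simp
  have diff\<psi>: "\<psi> ` B \<subseteq> ground M - \<psi> ` S" if "S \<subseteq> ground N" "B \<subseteq> ground N - S" for S B
    using image_mono[OF that(2), of \<psi>] inj_on_image_set_diff[OF injN Diff_subset that(1)] imN by simp
  have "coeff (coeff (Spec M) j) k = coeff (coeff (Spec N) j) k" for j k
    unfolding coeff_Spec[OF M] coeff_Spec[OF N]
  proof (rule sum.reindex_bij_witness[where j = "\<lambda>(S, B, I). (\<phi> ` S, \<phi> ` B, \<phi> ` I)"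
        and i = "\<lambda>(S, B, I). (\<psi> ` S, \<psi> ` B, \<psi> ` I)"], goal_cases)
    case (1 t)
    then obtain S B I where "t = (S, B, I)" "S \<subseteq> ground M" "B \<subseteq> ground M - S" "I \<subseteq> S" by auto
    moreover from this have "B \<subseteq> ground M" "I \<subseteq> ground M" by blast+
    ultimately show ?case using \<psi>\<phi> by simp
  next
    case (2 t)
    then obtain S B I where t: "t = (S, B, I)" "S \<subseteq> ground M" "card S = j" "B \<subseteq> ground M - S" "I \<subseteq> S" by auto
    then show ?case using diff\<phi>[OF t(2,4)] card\<phi>[OF t(2)] image_mono[OF t(2), of \<phi>] im by auto
  next
    case (3 t)
    then obtain S B I where "t = (S, B, I)" "S \<subseteq> ground N" "B \<subseteq> ground N - S" "I \<subseteq> S" by auto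
    moreover from this have "B \<subseteq> ground N" "I \<subseteq> ground N" by blast+
    ultimately show ?case using \<phi>\<psi> by simp
  next
    case (4 t)
    then obtain S B I where t: "t = (S, B, I)" "S \<subseteq> ground N" "card S = j" "B \<subseteq> ground N - S" "I \<subseteq> S" by auto
    then show ?case using diff\<psi>[OF t(2,4)] card\<psi>[OF t(2)] image_mono[OF t(2), of \<psi>] imN by auto
  next
    case (5 t)
    obtain S B I where t: "t = (S, B, I)" by (cases t)
    have sub: "S \<subseteq> ground M" "B \<subseteq> ground M" "I \<subseteq> ground M" using 5 t by auto
    have "rk N (\<phi> ` S \<union> \<phi> ` B) = rk M (S \<union> B)"
      using matroid_iso_rk[OF M N \<phi> ind, of "S \<union> B"] sub by (simp add: image_Un)
    then show ?case using ind[OF sub(3)] card\<phi> sub t by simp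
  qed
  then show ?thesis by (simp add: poly_eq_iff)
qed

theorem corollary9p25:
  shows "valuative_invariant Spec"
  unfolding valuative_invariant_def using valuation_Spec Spec_iso by blast

end
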